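(* Let $T>0$, $u_0\in\mathrm{BUC}(\mathbb R^d)$ and $A=\{0,\pm e_1,\dots,\pm e_d\}\subset\mathbb Z^d$. For $\varepsilon>0$ let $h_\varepsilon:\mathbb Z^d\times\mathbb Z_+\to\mathbb R$ be defined by $$h_\varepsilon(x,0)=u_0(\varepsilon x),\qquad h_\varepsilon(x,t+1)=\max_{a\in A}h_\varepsilon(x+a,t),$$ and let $u^\varepsilon:\mathbb R^d\times[0,T]\to\mathbb R$ be given by $u^\varepsilon(x,t)=h_\varepsilon([x/\varepsilon],[t/\varepsilon])$. Then, as $\varepsilon\to0$, $u^\varepsilon\to u$ locally uniformly in $\mathbb R^d\times[0,T]$, where $u\in\mathrm{BUC}(\mathbb R^d\times[0,T])$ is the unique viscosity solution of $$u_t=H(Du)\ \text{ in }\ \mathbb R^d\times(0,T],\qquad u(\cdot,0)=u_0,\qquad\text{with } H(p)=\max_{i=1,\dots,d}|p_i| .$$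
   Context: $e_1,\dots,e_d$ are the standard basis vectors of $\mathbb R^d$; $\mathbb Z_+$ is the set of nonnegative integers; $[t]$ is the integer part of $t\in\mathbb R$ (so that $[t+1]=[t]+1$), and $[x]=([x_1],\dots,[x_d])$ for $x\in\mathbb R^d$. $\mathrm{BUC}(\mathcal O)$ is the space of bounded uniformly continuous real functions on $\mathcal O$. Viscosity solutions are in the sense of Crandall–Lions. *)

theory Defs
  imports "HOL-Analysis.Analysis"
begin

definition BUC :: "'a::metric_space set \<Rightarrow> ('a \<Rightarrow> real) \<Rightarrow> bool" where
  "BUC S f \<longleftrightarrow> bounded (f ` S) \<and> uniformly_continuous_on S f"

text \<open>Viscosity solutions (Crandall--Lions) of \<open>u\<^sub>t = H(Du)\<close> on a set \<open>Q\<close> of points \<open>(x, t)\<close>.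
  \<open>Q\<close> need not be open (below it is \<open>\<real>\<^sup>d \<times> (0,T]\<close>): derivatives of test
  functions and local extrema are taken relative to \<open>Q\<close>, so at \<open>t = T\<close> only times
  \<open>t \<le> T\<close> matter.\<close>

text \<open>\<open>\<phi> \<in> C\<^sup>1(Q)\<close> with spatial gradient \<open>D\<phi>\<close> and time derivative \<open>\<phi>t\<close>.\<close>

definition C1_test ::
  "('a::euclidean_space \<times> real) set \<Rightarrow> ('a \<times> real \<Rightarrow> real) \<Rightarrow> ('a \<times> real \<Rightarrow> 'a)
    \<Rightarrow> ('a \<times> real \<Rightarrow> real) \<Rightarrow> bool" where
  "C1_test Q \<phi> D\<phi> \<phi>t \<longleftrightarrow> continuous_on Q D\<phi> \<and> continuous_on Q \<phi>t \<and>
     (\<forall>z\<in>Q. (\<phi> has_derivative (\<lambda>(y, s). D\<phi> z \<bullet> y + \<phi>t z * s)) (at z within Q))"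

definition viscosity_subsolution ::
  "('a::euclidean_space \<Rightarrow> real) \<Rightarrow> ('a \<times> real) set \<Rightarrow> ('a \<times> real \<Rightarrow> real) \<Rightarrow> bool" where
  "viscosity_subsolution H Q u \<longleftrightarrow>
     (\<forall>\<phi> D\<phi> \<phi>t. C1_test Q \<phi> D\<phi> \<phi>t \<longrightarrow>
       (\<forall>z\<in>Q. (\<forall>\<^sub>F w in at z within Q. u w - \<phi> w \<le> u z - \<phi> z) \<longrightarrow> \<phi>t z \<le> H (D\<phi> z)))"

definition viscosity_supersolution ::
  "('a::euclidean_space \<Rightarrow> real) \<Rightarrow> ('a \<times> real) set \<Rightarrow> ('a \<times> real \<Rightarrow> real) \<Rightarrow> bool" where
  "viscosity_supersolution H Q u \<longleftrightarrow>
     (\<forall>\<phi> D\<phi> \<phi>t. C1_test Q \<phi> D\<phi> \<phi>t \<longrightarrow>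
       (\<forall>z\<in>Q. (\<forall>\<^sub>F w in at z within Q. u w - \<phi> w \<ge> u z - \<phi> z) \<longrightarrow> \<phi>t z \<ge> H (D\<phi> z)))"

definition viscosity_solution ::
  "('a::euclidean_space \<Rightarrow> real) \<Rightarrow> ('a \<times> real) set \<Rightarrow> ('a \<times> real \<Rightarrow> real) \<Rightarrow> bool" where
  "viscosity_solution H Q u \<longleftrightarrow>
     continuous_on Q u \<and> viscosity_subsolution H Q u \<and> viscosity_supersolution H Q u"

definition viscosity_solution_IVP ::
  "('a::euclidean_space \<Rightarrow> real) \<Rightarrow> real \<Rightarrow> ('a \<Rightarrow> real) \<Rightarrow> ('a \<times> real \<Rightarrow> real) \<Rightarrow> bool" where
  "viscosity_solution_IVP H T u0 u \<longleftrightarrow>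
     viscosity_solution H (UNIV \<times> {0<..T}) u \<and> (\<forall>x. u (x, 0) = u0 x)"

definition max_abs :: "real ^ 'n \<Rightarrow> real" where
  "max_abs p = Max (range (\<lambda>i. \<bar>p $ i\<bar>))"

definition neighbours :: "(int ^ 'n) set" where
  "neighbours = {0} \<union> range (\<lambda>i. axis i 1) \<union> range (\<lambda>i. - axis i 1)"

primrec height :: "(real ^ 'n \<Rightarrow> real) \<Rightarrow> real \<Rightarrow> int ^ 'n \<Rightarrow> nat \<Rightarrow> real" where
  "height u0 \<epsilon> x 0 = u0 (\<epsilon> *\<^sub>R (\<chi> i. real_of_int (x $ i)))"
| "height u0 \<epsilon> x (Suc t) = Max ((\<lambda>a. height u0 \<epsilon> (x + a) t) ` neighbours)"

text \<open>Used only for \<open>\<epsilon> > 0\<close> and \<open>t \<ge> 0\<close>, where \<open>nat\<close> does not truncate.\<close>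

definition rescaled :: "(real ^ 'n \<Rightarrow> real) \<Rightarrow> real \<Rightarrow> (real ^ 'n) \<times> real \<Rightarrow> real" where
  "rescaled u0 \<epsilon> = (\<lambda>(x, t). height u0 \<epsilon> (\<chi> i. \<lfloor>x $ i / \<epsilon>\<rfloor>) (nat \<lfloor>t / \<epsilon>\<rfloor>))"

end

theory Submission
  imports Defs
begin

text \<open>
  The Hamiltonian \<open>H(p) = max\<^sub>i \<bar>p\<^sub>i\<bar>\<close> is the support function of the unit ball \<open>B\<close> of the
  \<open>\<ell>\<^sup>1\<close> norm, so the equation describes optimal motion with velocities in \<open>B\<close>, and its solution is
  given by the Hopf--Lax formula \<open>u(x, t) = sup {u\<^sub>0 y | \<bar>y - x\<bar>\<^sub>1 \<le> t}\<close>. The growth model has the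
  same form on the lattice: \<open>t\<close> steps by neighbours reach exactly the lattice points at \<open>\<ell>\<^sup>1\<close> distance
  at most \<open>t\<close>, so \<open>h\<^sub>\<epsilon>(x, t)\<close> is the maximum of \<open>u\<^sub>0(\<epsilon> y)\<close> over the lattice points \<open>y\<close> with
  \<open>\<bar>y - x\<bar>\<^sub>1 \<le> t\<close> (\<open>height_ge\<close>, \<open>height_attained\<close>).

  Convergence is then a comparison of two maxima of \<open>u\<^sub>0\<close>, over a ball and over the lattice points
  of spacing \<open>\<epsilon>\<close> in nearly the same ball. Each point of either set lies within a constant times
  \<open>\<epsilon>\<close> of a point of the other, so the maxima differ by at most the modulus of continuity of \<open>u\<^sub>0\<close>
  at that distance (\<open>rescaled_close_to_hopf_lax\<close>). The estimate is uniform in all of space and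
  time.

  That \<open>u\<close> is a viscosity solution follows from the dynamic programming principle along straight
  lines: going back in time from \<open>(x, t)\<close> with a velocity \<open>q \<in> B\<close>, \<open>u\<close> never exceeds
  \<open>u(x, t)\<close>, and for one \<open>q\<close> it stays equal to it (\<open>hopf_lax_backward_le\<close>,
  \<open>hopf_lax_backward_eq\<close>). A test function touching \<open>u\<close> at \<open>(x, t)\<close> inherits a one-sided inequality
  for its derivative in the direction \<open>(q, -1)\<close>, which is the viscosity inequality. Only earlier
  times are used, so the final time \<open>T\<close> is no exception.

  Uniqueness is the comparison principle for bounded uniformly continuous sub- and supersolutions
  (\<open>comparison_principle\<close>), by doubling the variables; it holds for every Lipschitz Hamiltonian.
\<close>

section \<open>The Hopf--Lax function of a convex set of velocities\<close>

definition hopf_lax :: "'a::real_normed_vector set \<Rightarrow> ('a \<Rightarrow> real) \<Rightarrow> 'a \<times> real \<Rightarrow> real" where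
  "hopf_lax B g = (\<lambda>(x, t). SUP q\<in>B. g (x + t *\<^sub>R q))"

lemma hopf_lax_ge:
  assumes "bounded (range g)" "q \<in> B"
  shows "g (x + t *\<^sub>R q) \<le> hopf_lax B g (x, t)"
proof -
  have "bdd_above ((\<lambda>q. g (x + t *\<^sub>R q)) ` B)"
    by (rule bdd_above_mono[OF bounded_imp_bdd_above[OF assms(1)]]) auto
  then show ?thesis
    using assms(2) unfolding hopf_lax_def by (auto intro: cSUP_upper)
qed

lemma hopf_lax_attained:
  assumes "compact B" "B \<noteq> {}" "continuous_on UNIV g"
  obtains q where "q \<in> B" "hopf_lax B g (x, t) = g (x + t *\<^sub>R q)"
proof -
  have "continuous_on B (\<lambda>q. g (x + t *\<^sub>R q))"
    by (intro continuous_on_compose2[OF assms(3)] continuous_intros) auto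
  then obtain q where q: "q \<in> B" "\<And>p. p \<in> B \<Longrightarrow> g (x + t *\<^sub>R p) \<le> g (x + t *\<^sub>R q)"
    using continuous_attains_sup[OF assms(1,2)] by blast
  then have "(SUP p\<in>B. g (x + t *\<^sub>R p)) = g (x + t *\<^sub>R q)"
    by (intro cSup_eq_maximum) auto
  then show thesis using that q(1) by (simp add: hopf_lax_def)
qed

lemma hopf_lax_initial:
  assumes "B \<noteq> {}"
  shows "hopf_lax B g (x, 0) = g x"
  using assms by (simp add: hopf_lax_def)

lemma hopf_lax_BUC:
  assumes B: "compact B" "B \<noteq> {}" and g: "BUC UNIV g"
  shows "BUC S (hopf_lax B g)"
proof -
  have bg: "bounded (range g)" and ug: "uniformly_continuous_on UNIV g"
    using g by (auto simp: BUC_def)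
  have cg: "continuous_on UNIV g" by (rule uniformly_continuous_imp_continuous[OF ug])
  obtain R where R: "R > 0" "\<And>q. q \<in> B \<Longrightarrow> norm q \<le> R"
    using compact_imp_bounded[OF B(1)] unfolding bounded_pos by blast
  have "hopf_lax B g z \<in> range g" for z
    by (cases z) (metis hopf_lax_attained[OF B cg] rangeI)
  then have "bounded (hopf_lax B g ` S)"
    by (intro bounded_subset[OF bg]) auto
  moreover have "uniformly_continuous_on S (hopf_lax B g)"
    unfolding uniformly_continuous_on_def
  proof (intro allI impI)
    fix e :: real assume "e > 0"
    then obtain d where d: "d > 0" "\<And>x y. dist x y < d \<Longrightarrow> dist (g x) (g y) < e"
      using ug unfolding uniformly_continuous_on_def by (metis UNIV_I)
    have one_sided: "hopf_lax B g (x, t) < hopf_lax B g (y, s) + e"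
      if "dist (x, t) (y, s) < d / (1 + R)" for x y :: 'a and t s :: real
    proof -
      obtain q where q: "q \<in> B" "hopf_lax B g (x, t) = g (x + t *\<^sub>R q)"
        using hopf_lax_attained[OF B cg] by blast
      have "dist (x + t *\<^sub>R q) (y + s *\<^sub>R q) = norm ((x - y) + (t - s) *\<^sub>R q)"
        by (simp add: dist_norm algebra_simps)
      also have "\<dots> \<le> norm (x - y) + \<bar>t - s\<bar> * norm q"
        by (metis norm_triangle_ineq norm_scaleR)
      also have "\<dots> \<le> dist (x, t) (y, s) + dist (x, t) (y, s) * R"
        using dist_fst_le[of "(x, t)" "(y, s)"] dist_snd_le[of "(x, t)" "(y, s)"] R q(1)
        by (intro add_mono mult_mono) (auto simp: dist_norm)
      also have "\<dots> = dist (x, t) (y, s) * (1 + R)" by (simp add: algebra_simps)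
      also have "\<dots> < d" using that R(1) by (simp add: pos_less_divide_eq)
      finally have "dist (g (x + t *\<^sub>R q)) (g (y + s *\<^sub>R q)) < e" by (rule d(2))
      moreover have "g (y + s *\<^sub>R q) \<le> hopf_lax B g (y, s)"
        by (rule hopf_lax_ge[OF bg q(1)])
      ultimately show ?thesis using q(2) by (simp add: dist_real_def)
    qed
    show "\<exists>d>0. \<forall>x\<in>S. \<forall>x'\<in>S. dist x' x < d \<longrightarrow> dist (hopf_lax B g x') (hopf_lax B g x) < e"
    proof (intro exI[of _ "d / (1 + R)"] conjI ballI impI)
      show "d / (1 + R) > 0" using d R by simp
      fix z w :: "'a \<times> real" assume "dist w z < d / (1 + R)"
      then show "dist (hopf_lax B g w) (hopf_lax B g z) < e"
        using one_sided[of "fst z" "snd z" "fst w" "snd w"]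
          one_sided[of "fst w" "snd w" "fst z" "snd z"]
        by (simp add: dist_real_def dist_commute abs_less_iff)
    qed
  qed
  ultimately show ?thesis by (simp add: BUC_def)
qed

text \<open>Moving for time \<open>s\<close> with velocity \<open>q\<close> and then for time \<open>t - s\<close> with velocity \<open>p\<close> has the
  same effect as moving for time \<open>t\<close> with the averaged velocity, which lies in \<open>B\<close> by convexity.\<close>

lemma hopf_lax_backward_le:
  assumes B: "compact B" "convex B" "q \<in> B" and g: "bounded (range g)" "continuous_on UNIV g"
    and s: "0 \<le> s" "s \<le> t" "0 < t"
  shows "hopf_lax B g (x + s *\<^sub>R q, t - s) \<le> hopf_lax B g (x, t)"
proof -
  obtain p where p: "p \<in> B"
    "hopf_lax B g (x + s *\<^sub>R q, t - s) = g (x + s *\<^sub>R q + (t - s) *\<^sub>R p)"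
    using hopf_lax_attained[OF B(1) _ g(2)] B(3) by blast
  \<comment> \<open>the averaged velocity\<close>
  define r where "r = (s / t) *\<^sub>R q + ((t - s) / t) *\<^sub>R p"
  have "s / t + (t - s) / t = 1"
    using s by (simp add: add_divide_distrib[symmetric])
  then have "r \<in> B" unfolding r_def using s
    by (intro convexD[OF B(2) B(3) p(1)]) auto
  moreover have "t *\<^sub>R r = s *\<^sub>R q + (t - s) *\<^sub>R p"
    using s by (simp add: r_def scaleR_add_right)
  ultimately show ?thesis
    using hopf_lax_ge[OF g(1), of r B x t] p(2) by (simp add: add.assoc)
qed

text \<open>The velocity \<open>q\<close> that is optimal for \<open>(x, t)\<close> remains optimal along the straight line that it
  generates, since all points of this line have the same endpoint at time \<open>0\<close>. One \<open>q\<close> therefore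
  works for all \<open>s\<close>, which allows to differentiate along the line.\<close>

lemma hopf_lax_backward_eq:
  assumes B: "compact B" "convex B" "B \<noteq> {}" and g: "bounded (range g)" "continuous_on UNIV g"
    and t: "0 < t"
  obtains q where "q \<in> B" 
    "\<And>s. 0 \<le> s \<Longrightarrow> s \<le> t \<Longrightarrow> hopf_lax B g (x + s *\<^sub>R q, t - s) = hopf_lax B g (x, t)"
proof -
  obtain q where q: "q \<in> B" "hopf_lax B g (x, t) = g (x + t *\<^sub>R q)"
    using hopf_lax_attained[OF B(1,3) g(2)] by blast
  show thesis
  proof (rule that[OF q(1)], rule antisym)
    fix s :: real assume s: "0 \<le> s" "s \<le> t"
    show "hopf_lax B g (x + s *\<^sub>R q, t - s) \<le> hopf_lax B g (x, t)"
      by (rule hopf_lax_backward_le[OF B(1,2) q(1) g s t])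
    have "x + s *\<^sub>R q + (t - s) *\<^sub>R q = x + t *\<^sub>R q" by (simp add: algebra_simps)
    then show "hopf_lax B g (x, t) \<le> hopf_lax B g (x + s *\<^sub>R q, t - s)"
      using hopf_lax_ge[OF g(1) q(1), of "x + s *\<^sub>R q" "t - s"] q(2) by metis
  qed
qed

section \<open>The Hopf--Lax function is a viscosity solution\<close>

text \<open>The domain \<open>Q\<close> of a test function is not open, so the directional derivative is recovered
  from the derivative within \<open>Q\<close> along a ray whose beginning stays in \<open>Q\<close>.\<close>

lemma has_derivative_ray_nonneg:
  fixes \<phi> :: "'a::real_normed_vector \<Rightarrow> real"
  assumes deriv: "(\<phi> has_derivative D) (at z within Q)"
    and ray: "\<forall>\<^sub>F s in at_right 0. z + s *\<^sub>R w \<in> Q"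
    and ge: "\<forall>\<^sub>F s in at_right 0. \<phi> z \<le> \<phi> (z + s *\<^sub>R w)"
  shows "0 \<le> D w"
proof -
  obtain e where e: "e > 0" "\<And>s. 0 < s \<Longrightarrow> s < e \<Longrightarrow> z + s *\<^sub>R w \<in> Q \<and> \<phi> z \<le> \<phi> (z + s *\<^sub>R w)"
    using eventually_conj[OF ray ge] unfolding eventually_at_right_field by auto
  have "((\<lambda>s. \<phi> (z + s *\<^sub>R w)) has_derivative (\<lambda>s. D (s *\<^sub>R w))) (at 0 within {0<..<e})"
  proof (rule has_derivative_in_compose[where f="\<lambda>s. z + s *\<^sub>R w" and g=\<phi>])
    show "((\<lambda>s. z + s *\<^sub>R w) has_derivative (\<lambda>s. s *\<^sub>R w)) (at 0 within {0<..<e})"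
      by (auto intro!: derivative_eq_intros)
    show "(\<phi> has_derivative D) (at (z + 0 *\<^sub>R w) within (\<lambda>s. z + s *\<^sub>R w) ` {0<..<e})"
      using e(2) by (auto intro!: has_derivative_subset[OF deriv])
  qed
  moreover have "D (s *\<^sub>R w) = D w * s" for s
    using has_derivative_bounded_linear[OF deriv] by (simp add: linear_simps)
  ultimately have "((\<lambda>s. \<phi> (z + s *\<^sub>R w)) has_real_derivative D w) (at 0 within {0<..<e})"
    by (simp add: has_field_derivative_def)
  then have "((\<lambda>s. (\<phi> (z + s *\<^sub>R w) - \<phi> z) / s) \<longlongrightarrow> D w) (at 0 within {0<..<e})"
    by (simp add: has_field_derivative_iff)
  moreover have "at (0::real) within {0<..<e} = at_right 0"
    using e(1) by (intro at_within_nhd[where S="{-e<..<e}"]) auto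
  ultimately have lim: "((\<lambda>s. (\<phi> (z + s *\<^sub>R w) - \<phi> z) / s) \<longlongrightarrow> D w) (at_right 0)" by simp
  have "\<forall>\<^sub>F s in at_right 0. 0 \<le> (\<phi> (z + s *\<^sub>R w) - \<phi> z) / s"
    unfolding eventually_at_right_field using e by (intro exI[of _ e]) auto
  then show ?thesis by (intro tendsto_lowerbound[OF lim]) auto
qed

lemma filterlim_ray:
  fixes z w :: "'a::real_normed_vector"
  assumes "w \<noteq> 0" and "\<forall>\<^sub>F s in at_right 0. z + s *\<^sub>R w \<in> Q"
  shows "filterlim (\<lambda>s. z + s *\<^sub>R w) (at z within Q) (at_right 0)"
  unfolding filterlim_at
proof
  have "((\<lambda>s. z + s *\<^sub>R w) \<longlongrightarrow> z + 0 *\<^sub>R w) (at_right 0)"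
    by (intro tendsto_intros)
  then show "((\<lambda>s. z + s *\<^sub>R w) \<longlongrightarrow> z) (at_right 0)" by simp
  have "\<forall>\<^sub>F s in at_right 0. s > (0::real)" by (simp add: eventually_at_right_less)
  with assms(2) show "\<forall>\<^sub>F s in at_right 0. z + s *\<^sub>R w \<in> Q \<and> z + s *\<^sub>R w \<noteq> z"
    by eventually_elim (use assms(1) in auto)
qed

text \<open>Rays that go backward in time stay in the slab even when they start at its final time.\<close>

lemma backward_ray_in_slab:
  fixes x q :: "'a::real_normed_vector" and t T :: real
  assumes "0 < t" "t \<le> T"
  shows "\<forall>\<^sub>F s in at_right 0. (x, t) + s *\<^sub>R (q, -1) \<in> UNIV \<times> {0<..T}"
  unfolding eventually_at_right_field by (rule exI[of _ t]) (use assms in auto)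

text \<open>Along the optimal line \<open>u\<close> is constant, so a test function that touches \<open>u\<close> from above does not
  decrease along it: \<open>0 \<le> D\<phi> \<bullet> q - \<phi>\<^sub>t\<close>, and \<open>D\<phi> \<bullet> q \<le> H(D\<phi>)\<close>.\<close>

lemma hopf_lax_subsolution:
  fixes B :: "'a::euclidean_space set"
  assumes B: "compact B" "convex B" "B \<noteq> {}" and g: "bounded (range g)" "continuous_on UNIV g"
    and H: "\<And>p q. q \<in> B \<Longrightarrow> p \<bullet> q \<le> H p"
  shows "viscosity_subsolution H (UNIV \<times> {0<..T}) (hopf_lax B g)"
  unfolding viscosity_subsolution_def
proof (intro allI impI ballI)
  fix \<phi> :: "'a \<times> real \<Rightarrow> real" and D\<phi> \<phi>t z
  let ?Q = "UNIV \<times> {0<..T} :: ('a \<times> real) set" and ?u = "hopf_lax B g"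
  assume C1: "C1_test ?Q \<phi> D\<phi> \<phi>t" and zQ: "z \<in> ?Q"
    and max: "\<forall>\<^sub>F w in at z within ?Q. ?u w - \<phi> w \<le> ?u z - \<phi> z"
  obtain x t where z: "z = (x, t)" by force
  have t: "0 < t" "t \<le> T" using zQ z by auto
  obtain q where q: "q \<in> B" "\<And>s. 0 \<le> s \<Longrightarrow> s \<le> t \<Longrightarrow> ?u (x + s *\<^sub>R q, t - s) = ?u (x, t)"
    using hopf_lax_backward_eq[OF B g t(1)] by blast
  have ray: "\<forall>\<^sub>F s in at_right 0. z + s *\<^sub>R (q, -1) \<in> ?Q"
    unfolding z by (rule backward_ray_in_slab[OF t])
  have "\<forall>\<^sub>F s in at_right 0. ?u (z + s *\<^sub>R (q, -1)) - \<phi> (z + s *\<^sub>R (q, -1)) \<le> ?u z - \<phi> z"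
    by (rule eventually_compose_filterlim[OF max filterlim_ray[OF _ ray]]) (simp add: zero_prod_def)
  moreover have "\<forall>\<^sub>F s in at_right 0. ?u (z + s *\<^sub>R (q, -1)) = ?u z"
    unfolding eventually_at_right_field using q(2) t z by (intro exI[of _ t]) auto
  ultimately have "\<forall>\<^sub>F s in at_right 0. \<phi> z \<le> \<phi> (z + s *\<^sub>R (q, -1))"
    by eventually_elim auto
  moreover have "(\<phi> has_derivative (\<lambda>(y, s). D\<phi> z \<bullet> y + \<phi>t z * s)) (at z within ?Q)"
    using C1 zQ by (auto simp: C1_test_def)
  ultimately have "0 \<le> (case (q, -1) of (y, s) \<Rightarrow> D\<phi> z \<bullet> y + \<phi>t z * s)"
    using ray by (intro has_derivative_ray_nonneg)
  then show "\<phi>t z \<le> H (D\<phi> z)" using H[OF q(1), of "D\<phi> z"] by simp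
qed

text \<open>Along every backward line \<open>u\<close> is at most its value at \<open>(x, t)\<close>, so a test function that touches \<open>u\<close> from
  below does not increase along it: \<open>D\<phi> \<bullet> q - \<phi>\<^sub>t \<le> 0\<close>. The choice of \<open>q\<close> with
  \<open>H(D\<phi>) \<le> D\<phi> \<bullet> q\<close> gives the claim.\<close>

lemma hopf_lax_supersolution:
  fixes B :: "'a::euclidean_space set"
  assumes B: "compact B" "convex B" and g: "bounded (range g)" "continuous_on UNIV g"
    and H: "\<And>p. \<exists>q\<in>B. H p \<le> p \<bullet> q"
  shows "viscosity_supersolution H (UNIV \<times> {0<..T}) (hopf_lax B g)"
  unfolding viscosity_supersolution_def
proof (intro allI impI ballI)
  fix \<phi> :: "'a \<times> real \<Rightarrow> real" and D\<phi> \<phi>t z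
  let ?Q = "UNIV \<times> {0<..T} :: ('a \<times> real) set" and ?u = "hopf_lax B g"
  assume C1: "C1_test ?Q \<phi> D\<phi> \<phi>t" and zQ: "z \<in> ?Q"
    and min: "\<forall>\<^sub>F w in at z within ?Q. ?u w - \<phi> w \<ge> ?u z - \<phi> z"
  obtain x t where z: "z = (x, t)" by force
  have t: "0 < t" "t \<le> T" using zQ z by auto
  obtain q where q: "q \<in> B" "H (D\<phi> z) \<le> D\<phi> z \<bullet> q" using H by blast
  have ray: "\<forall>\<^sub>F s in at_right 0. z + s *\<^sub>R (q, -1) \<in> ?Q"
    unfolding z by (rule backward_ray_in_slab[OF t])
  have "\<forall>\<^sub>F s in at_right 0. ?u (z + s *\<^sub>R (q, -1)) - \<phi> (z + s *\<^sub>R (q, -1)) \<ge> ?u z - \<phi> z"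
    by (rule eventually_compose_filterlim[OF min filterlim_ray[OF _ ray]]) (simp add: zero_prod_def)
  moreover have "\<forall>\<^sub>F s in at_right 0. ?u (z + s *\<^sub>R (q, -1)) \<le> ?u z"
    unfolding eventually_at_right_field using hopf_lax_backward_le[OF B q(1) g] t z
    by (intro exI[of _ t]) auto
  ultimately have "\<forall>\<^sub>F s in at_right 0. - \<phi> z \<le> - \<phi> (z + s *\<^sub>R (q, -1))"
    by eventually_elim auto
  moreover have "((\<lambda>w. - \<phi> w) has_derivative (\<lambda>w. - (case w of (y, s) \<Rightarrow> D\<phi> z \<bullet> y + \<phi>t z * s))) (at z within ?Q)"
    using C1 zQ by (intro has_derivative_minus) (auto simp: C1_test_def)
  ultimately have "0 \<le> - (case (q, -1) of (y, s) \<Rightarrow> D\<phi> z \<bullet> y + \<phi>t z * s)"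
    using ray by (intro has_derivative_ray_nonneg[where \<phi>="\<lambda>w. - \<phi> w"])
  then show "\<phi>t z \<ge> H (D\<phi> z)" using q(2) by simp
qed

section \<open>Comparison of bounded uniformly continuous sub- and supersolutions\<close>

text \<open>With \<open>A\<close> replaced by \<open>- A\<close> and \<open>l = d = 0\<close>, this family also contains the test functions for
  the supersolution in the doubling argument.\<close>

lemma C1_test_quadratic:
  fixes y0 :: "'a::euclidean_space"
  shows "C1_test Q
    (\<lambda>(x, t). A * ((x - y0) \<bullet> (x - y0)) + A * (t - s0)\<^sup>2 + l * t + d * (x \<bullet> x))
    (\<lambda>(x, t). (2 * A) *\<^sub>R (x - y0) + (2 * d) *\<^sub>R x)
    (\<lambda>(x, t). 2 * A * (t - s0) + l)"
  unfolding C1_test_def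
proof (intro conjI ballI)
  show "continuous_on Q (\<lambda>(x, t). (2 * A) *\<^sub>R (x - y0) + (2 * d) *\<^sub>R x)"
    unfolding case_prod_beta by (intro continuous_intros)
  show "continuous_on Q (\<lambda>(x::'a, t). 2 * A * (t - s0) + l)"
    unfolding case_prod_beta by (intro continuous_intros)
  fix z :: "'a \<times> real"
  show "((\<lambda>(x, t). A * ((x - y0) \<bullet> (x - y0)) + A * (t - s0)\<^sup>2 + l * t + d * (x \<bullet> x))
     has_derivative (\<lambda>(y, s). (case z of (x, t) \<Rightarrow> (2 * A) *\<^sub>R (x - y0) + (2 * d) *\<^sub>R x) \<bullet> y +
                     (case z of (x, t) \<Rightarrow> 2 * A * (t - s0) + l) * s)) (at z within Q)"
    unfolding case_prod_beta
    by (auto intro!: derivative_eq_intros simp: algebra_simps inner_commute)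
qed

text \<open>The penalty \<open>d \<bar>x\<bar>\<^sup>2\<close> bounds \<open>x\<close>, and \<open>A \<bar>x - y\<bar>\<^sup>2\<close> then bounds \<open>y\<close>, wherever \<open>\<Phi>\<close> is
  nonnegative. A maximum over a large compact set is thus a maximum over everything, as soon as
  \<open>\<Phi>\<close> is nonnegative somewhere.\<close>

lemma doubling_maximum:
  fixes v w :: "'a::euclidean_space \<times> real \<Rightarrow> real"
  assumes cont: "continuous_on (UNIV \<times> {0..T}) v" "continuous_on (UNIV \<times> {0..T}) w"
    and bound: "\<forall>z \<in> UNIV \<times> {0..T}. \<bar>v z\<bar> \<le> C" "\<forall>z \<in> UNIV \<times> {0..T}. \<bar>w z\<bar> \<le> C"
    and pos: "A > 0" "d > 0" "l \<ge> 0"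
    and \<Phi>: "\<And>x t y s. \<Phi> x t y s = v (x, t) - w (y, s) 
      - (A * ((x - y) \<bullet> (x - y)) + A * (t - s)\<^sup>2 + l * t + d * (x \<bullet> x))"
    and start: "t1 \<in> {0..T}" "\<Phi> x1 t1 x1 t1 \<ge> 0"
  shows "\<exists>x0 t0 y0 s0. t0 \<in> {0..T} \<and> s0 \<in> {0..T} \<and>
    (\<forall>x y. \<forall>t\<in>{0..T}. \<forall>s\<in>{0..T}. \<Phi> x t y s \<le> \<Phi> x0 t0 y0 s0)"
proof -
  have C: "C \<ge> 0" using bspec[OF bound(1), of "(x1, t1)"] start(1) by auto
  define R where "R = sqrt (2 * C / d)"
  define R' where "R' = R + sqrt (2 * C / A)"
  have far: "norm x \<le> R \<and> norm y \<le> R'"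
    if ts: "t \<in> {0..T}" "s \<in> {0..T}" and nn: "\<Phi> x t y s \<ge> 0" for x t y s
  proof -
    have b: "v (x, t) - w (y, s) \<le> 2 * C"
      using bspec[OF bound(1), of "(x, t)"] bspec[OF bound(2), of "(y, s)"] ts by auto
    have p: "A * ((x - y) \<bullet> (x - y)) \<ge> 0" "A * (t - s)\<^sup>2 \<ge> 0" "l * t \<ge> 0" "d * (x \<bullet> x) \<ge> 0"
      using pos ts by auto
    have "d * (x \<bullet> x) \<le> 2 * C" "A * ((x - y) \<bullet> (x - y)) \<le> 2 * C"
      using nn[unfolded \<Phi>] p b by linarith+
    then have "(norm x)\<^sup>2 \<le> 2 * C / d" "(norm (x - y))\<^sup>2 \<le> 2 * C / A"
      using pos by (simp_all add: power2_norm_eq_inner pos_le_divide_eq mult.commute)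
    then have "norm x \<le> R" "norm (x - y) \<le> sqrt (2 * C / A)"
      unfolding R_def by (simp_all add: real_le_rsqrt)
    moreover have "norm y \<le> norm x + norm (x - y)"
      by (metis norm_triangle_sub norm_minus_commute)
    ultimately show ?thesis by (simp add: R'_def)
  qed
  define K where "K = (cball (0::'a) R \<times> {0..T}) \<times> (cball (0::'a) R' \<times> {0..T})"
  have "compact K" unfolding K_def by (intro compact_Times compact_cball compact_Icc)
  moreover have start_K: "((x1, t1), (x1, t1)) \<in> K"
    using far[OF start(1,1,2)] start(1) by (auto simp: K_def)
  moreover have "continuous_on K (\<lambda>p. \<Phi> (fst (fst p)) (snd (fst p)) (fst (snd p)) (snd (snd p)))"
    unfolding \<Phi> prod.collapse
    by (intro continuous_intros continuous_on_compose2[OF cont(1)] continuous_on_compose2[OF cont(2)])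
      (auto simp: K_def)
  ultimately obtain p where p: "p \<in> K" 
    "\<And>r. r \<in> K \<Longrightarrow> \<Phi> (fst (fst r)) (snd (fst r)) (fst (snd r)) (snd (snd r))
       \<le> \<Phi> (fst (fst p)) (snd (fst p)) (fst (snd p)) (snd (snd p))"
    using continuous_attains_sup[of K "\<lambda>p. \<Phi> (fst (fst p)) (snd (fst p)) (fst (snd p)) (snd (snd p))"] by blast
  obtain x0 t0 y0 s0 where pe: "p = ((x0, t0), (y0, s0))" by (metis surj_pair)
  show ?thesis
  proof (intro exI conjI allI ballI)
    show "t0 \<in> {0..T}" "s0 \<in> {0..T}" using p(1) by (auto simp: pe K_def)
    fix x t y s assume ts: "t \<in> {0..T}" "s \<in> {0..T}"
    show "\<Phi> x t y s \<le> \<Phi> x0 t0 y0 s0"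
    proof (cases "\<Phi> x t y s \<ge> 0")
      case True
      then have "((x, t), (y, s)) \<in> K" using far[OF ts True] ts by (auto simp: K_def)
      from p(2)[OF this] show ?thesis by (simp add: pe)
    next
      case False
      with p(2)[OF start_K] start(2) show ?thesis by (simp add: pe)
    qed
  qed
qed

text \<open>Suppose that \<open>v - w\<close> is positive somewhere and let \<open>(x0, t0, y0, s0)\<close> maximise
  \<open>v(x, t) - w(y, s) - A \<bar>x - y\<bar>\<^sup>2 - A (t - s)\<^sup>2 - l t - d \<bar>x\<bar>\<^sup>2\<close>. A large \<open>A\<close> forces the two
  points together, and uniform continuity and the initial inequality then exclude \<open>t0 = 0\<close> and
  \<open>s0 = 0\<close>. In the two viscosity inequalities the terms with \<open>A\<close> are the same and cancel. What
  remains is \<open>l \<le> 2 L d \<bar>x0\<bar>\<close>, and \<open>d \<bar>x0\<bar>\<close> tends to \<open>0\<close> with \<open>d\<close> because \<open>d \<bar>x0\<bar>\<^sup>2\<close> is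
  bounded in terms of the sup norms of \<open>v\<close> and \<open>w\<close>.\<close>

lemma comparison_principle:
  fixes v w :: "'a::euclidean_space \<times> real \<Rightarrow> real"
  assumes v: "BUC (UNIV \<times> {0..T}) v" "viscosity_subsolution H (UNIV \<times> {0<..T}) v"
    and w: "BUC (UNIV \<times> {0..T}) w" "viscosity_supersolution H (UNIV \<times> {0<..T}) w"
    and lip: "\<And>p q. H p \<le> H q + L * norm (p - q)" 
    and init: "\<And>x. v (x, 0) \<le> w (x, 0)"
    and z: "z \<in> UNIV \<times> {0..T}"
  shows "v z \<le> w z"
proof (rule ccontr)
  let ?S = "UNIV \<times> {0..T} :: ('a \<times> real) set"
  assume neg: "\<not> v z \<le> w z"
  obtain x1 t1 where z1: "z = (x1, t1)" by force
  have t1: "t1 \<in> {0..T}" using z z1 by auto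
  then have T: "T \<ge> 0" by auto
  define m where "m = v z - w z"
  have m: "m > 0" using neg by (simp add: m_def)
  have uv: "uniformly_continuous_on ?S v" and uw: "uniformly_continuous_on ?S w"
    using v w by (auto simp: BUC_def)
  have "bounded (v ` ?S \<union> w ` ?S)" using v w by (simp add: BUC_def bounded_Un)
  then obtain C where C: "C > 0" "\<And>y. y \<in> v ` ?S \<union> w ` ?S \<Longrightarrow> norm y \<le> C"
    unfolding bounded_pos by blast
  have bv: "\<forall>y\<in>?S. \<bar>v y\<bar> \<le> C" and bw: "\<forall>y\<in>?S. \<bar>w y\<bar> \<le> C"
    using C(2) by (auto simp: real_norm_def)
  obtain rv where rv: "rv > 0" "\<And>a b. a \<in> ?S \<Longrightarrow> b \<in> ?S \<Longrightarrow> dist a b < rv \<Longrightarrow> \<bar>v a - v b\<bar> < m / 2"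
    using uv half_gt_zero[OF m] unfolding uniformly_continuous_on_def dist_real_def by metis
  obtain rw where rw: "rw > 0" "\<And>a b. a \<in> ?S \<Longrightarrow> b \<in> ?S \<Longrightarrow> dist a b < rw \<Longrightarrow> \<bar>w a - w b\<bar> < m / 2"
    using uw half_gt_zero[OF m] unfolding uniformly_continuous_on_def dist_real_def by metis
  define r where "r = min rv rw"
  have r: "r > 0" using rv rw by (simp add: r_def)
  \<comment> \<open>The value at the maximum is nonnegative, so every penalty is at most \<open>2 C\<close> there; this \<open>A\<close>
    makes the distance of the two points less than \<open>r\<close>. The constants \<open>l\<close> and \<open>d\<close> lower
    the value at \<open>z\<close> by at most \<open>m / 4\<close> each, and the second bound on \<open>d\<close> makes
    \<open>(2 L d \<bar>x0\<bar>)\<^sup>2 \<le> 8 L\<^sup>2 C d < l\<^sup>2\<close>.\<close>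
  define A where "A = 4 * C / r\<^sup>2"
  define l where "l = m / (4 * (T + 1))"
  define d where "d = min (m / (4 * (x1 \<bullet> x1 + 1))) (l\<^sup>2 / (16 * C * (L\<^sup>2 + 1)))"
  have A: "A > 0" using C r by (simp add: A_def)
  have l: "l > 0" using m T by (simp add: l_def)
  have L1: "L\<^sup>2 + 1 > 0" by (simp add: add_nonneg_pos)
  have d: "d > 0" using m l C L1 by (simp add: d_def add_nonneg_pos)
  define \<Phi> where "\<Phi> x t y s = v (x, t) - w (y, s) 
      - (A * ((x - y) \<bullet> (x - y)) + A * (t - s)\<^sup>2 + l * t + d * (x \<bullet> x))" for x t y s
  have lt: "l * t1 \<le> m / 4"
  proof -
    have "l * t1 \<le> l * (T + 1)" using l t1 by (intro mult_left_mono) auto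
    also have "\<dots> = m / 4" using T by (simp add: l_def divide_simps)
    finally show ?thesis .
  qed
  have dx: "d * (x1 \<bullet> x1) \<le> m / 4"
  proof -
    have p: "x1 \<bullet> x1 + 1 > 0" by (simp add: add_nonneg_pos)
    have "d * (x1 \<bullet> x1) \<le> d * (x1 \<bullet> x1 + 1)" using d by (intro mult_left_mono) auto
    also have "\<dots> \<le> m / (4 * (x1 \<bullet> x1 + 1)) * (x1 \<bullet> x1 + 1)"
      using p by (intro mult_right_mono) (auto simp: d_def)
    also have "\<dots> = m / 4" using p by (simp add: divide_simps)
    finally show ?thesis .
  qed
  have start: "\<Phi> x1 t1 x1 t1 \<ge> m / 2"
    using lt dx by (simp add: \<Phi>_def m_def z1)
  have cv: "continuous_on ?S v" and cw: "continuous_on ?S w"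
    using uv uw by (auto intro: uniformly_continuous_imp_continuous)
  have start0: "\<Phi> x1 t1 x1 t1 \<ge> 0" using start m by simp
  obtain x0 t0 y0 s0 where t0: "t0 \<in> {0..T}" and s0: "s0 \<in> {0..T}"
    and max: "\<And>x t y s. t \<in> {0..T} \<Longrightarrow> s \<in> {0..T} \<Longrightarrow> \<Phi> x t y s \<le> \<Phi> x0 t0 y0 s0"
    using doubling_maximum[OF cv cw bv bw A d less_imp_le[OF l] \<Phi>_def t1 start0] by blast
  have big: "\<Phi> x0 t0 y0 s0 \<ge> m / 2" using max[OF t1 t1, of x1 x1] start by simp
  have nn: "A * ((x0 - y0) \<bullet> (x0 - y0)) \<ge> 0" "A * (t0 - s0)\<^sup>2 \<ge> 0" "l * t0 \<ge> 0" "d * (x0 \<bullet> x0) \<ge> 0"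
    using A l d t0 by auto
  have pen: "A * ((x0 - y0) \<bullet> (x0 - y0)) + A * (t0 - s0)\<^sup>2 + d * (x0 \<bullet> x0) \<le> 2 * C"
    using big[unfolded \<Phi>_def] bspec[OF bv, of "(x0, t0)"] bspec[OF bw, of "(y0, s0)"] t0 s0 m nn by auto
  have gap: "m / 2 \<le> v (x0, t0) - w (y0, s0)"
    using big nn by (simp add: \<Phi>_def)
  have close: "dist (x0, t0) (y0, s0) < r"
  proof -
    have "A * ((norm (x0 - y0))\<^sup>2 + (t0 - s0)\<^sup>2) \<le> 2 * C"
      using pen nn(4) by (simp add: power2_norm_eq_inner distrib_left)
    also have "\<dots> < A * r\<^sup>2" using C r by (simp add: A_def)
    finally have "(norm (x0 - y0))\<^sup>2 + (t0 - s0)\<^sup>2 < r\<^sup>2" using A by simp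
    then show ?thesis using r
      by (simp add: dist_norm norm_Pair real_less_lsqrt)
  qed
  have "t0 \<noteq> 0"
  proof
    assume "t0 = 0"
    then have "\<bar>w (x0, 0) - w (y0, s0)\<bar> < m / 2"
      using close t0 s0 by (intro rw(2)) (auto simp: r_def)
    then show False using gap init[of x0] unfolding \<open>t0 = 0\<close> by linarith
  qed
  have "s0 \<noteq> 0"
  proof
    assume "s0 = 0"
    then have "\<bar>v (x0, t0) - v (y0, 0)\<bar> < m / 2"
      using close t0 s0 by (intro rv(2)) (auto simp: r_def)
    then show False using gap init[of y0] unfolding \<open>s0 = 0\<close> by linarith
  qed
  have Q: "(x0, t0) \<in> UNIV \<times> {0<..T}" "(y0, s0) \<in> UNIV \<times> {0<..T}"
    using \<open>t0 \<noteq> 0\<close> \<open>s0 \<noteq> 0\<close> t0 s0 by auto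
  let ?Q = "UNIV \<times> {0<..T} :: ('a \<times> real) set"
  have sub: "2 * A * (t0 - s0) + l \<le> H ((2 * A) *\<^sub>R (x0 - y0) + (2 * d) *\<^sub>R x0)"
  proof -
    let ?\<phi> = "\<lambda>(x, t). A * ((x - y0) \<bullet> (x - y0)) + A * (t - s0)\<^sup>2 + l * t + d * (x \<bullet> x)"
    have "v y - ?\<phi> y \<le> v (x0, t0) - ?\<phi> (x0, t0)" if "y \<in> ?Q" for y
      using max[of "snd y" s0 "fst y" y0] that s0 by (auto simp: \<Phi>_def case_prod_beta)
    then have "\<forall>\<^sub>F y in at (x0, t0) within ?Q. v y - ?\<phi> y \<le> v (x0, t0) - ?\<phi> (x0, t0)"
      by (auto simp: eventually_at_filter)
    then show ?thesis
      using v(2)[unfolded viscosity_subsolution_def, rule_format, OF C1_test_quadratic Q(1), of A y0 s0 l d]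
      by simp
  qed
  have super: "2 * A * (t0 - s0) \<ge> H ((2 * A) *\<^sub>R (x0 - y0))"
  proof -
    let ?\<phi> = "\<lambda>(x, t). - A * ((x - x0) \<bullet> (x - x0)) + - A * (t - t0)\<^sup>2 + 0 * t + 0 * (x \<bullet> x)"
    have sym: "(a - b) \<bullet> (a - b) = (b - a) \<bullet> (b - a)" for a b :: 'a
      by (metis norm_minus_commute power2_norm_eq_inner)
    have "w y - ?\<phi> y \<ge> w (y0, s0) - ?\<phi> (y0, s0)" if "y \<in> ?Q" for y
      using max[of t0 "snd y" x0 "fst y"] that t0
      by (auto simp: \<Phi>_def case_prod_beta sym[of x0] power2_commute[of t0])
    then have "\<forall>\<^sub>F y in at (y0, s0) within ?Q. w y - ?\<phi> y \<ge> w (y0, s0) - ?\<phi> (y0, s0)"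
      by (auto simp: eventually_at_filter)
    then show ?thesis
      using w(2)[unfolded viscosity_supersolution_def, rule_format, OF C1_test_quadratic Q(2), of "- A" x0 t0 0 0]
      by (simp add: algebra_simps)
  qed
  have "l \<le> L * norm ((2 * d) *\<^sub>R x0)"
    using sub super lip[of "(2 * A) *\<^sub>R (x0 - y0) + (2 * d) *\<^sub>R x0" "(2 * A) *\<^sub>R (x0 - y0)"] by simp
  then have "l\<^sup>2 \<le> (L * norm ((2 * d) *\<^sub>R x0))\<^sup>2" using l by (intro power_mono) auto
  also have "\<dots> = 4 * L\<^sup>2 * d * (d * (x0 \<bullet> x0))"
    by (simp add: power_mult_distrib power2_norm_eq_inner[symmetric] power2_eq_square)
  also have "\<dots> \<le> 4 * L\<^sup>2 * d * (2 * C)"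
    using pen nn d by (intro mult_left_mono) auto
  also have "\<dots> \<le> 4 * (L\<^sup>2 + 1) * d * (2 * C)"
    using d C by (intro mult_right_mono) auto
  also have "\<dots> \<le> 4 * (L\<^sup>2 + 1) * (l\<^sup>2 / (16 * C * (L\<^sup>2 + 1))) * (2 * C)"
    using C L1 by (intro mult_right_mono mult_left_mono) (auto simp: d_def)
  also have "\<dots> = l\<^sup>2 / 2" using C(1) L1 by (simp add: divide_simps)
  finally show False using l by simp
qed

section \<open>The maximum norm as a support function\<close>

definition l1_ball :: "(real ^ 'n) set" where
  "l1_ball = {q. (\<Sum>i\<in>UNIV. \<bar>q $ i\<bar>) \<le> 1}"

lemma compact_l1_ball: "compact (l1_ball :: (real ^ 'n) set)"
proof -
  have "closed (l1_ball :: (real ^ 'n) set)"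
    unfolding l1_ball_def by (intro closed_Collect_le continuous_intros)
  moreover have "bounded (l1_ball :: (real ^ 'n) set)"
    unfolding bounded_iff l1_ball_def using norm_le_l1_cart order_trans by blast
  ultimately show ?thesis by (simp add: compact_eq_bounded_closed)
qed

lemma convex_l1_ball: "convex l1_ball"
proof (rule convexI)
  fix p q :: "real ^ 'n" and a b :: real
  assume pq: "p \<in> l1_ball" "q \<in> l1_ball" and ab: "0 \<le> a" "0 \<le> b" "a + b = 1"
  have "(\<Sum>i\<in>UNIV. \<bar>(a *\<^sub>R p + b *\<^sub>R q) $ i\<bar>) \<le> (\<Sum>i\<in>UNIV. a * \<bar>p $ i\<bar> + b * \<bar>q $ i\<bar>)"
    using ab by (intro sum_mono) (auto intro!: order_trans[OF abs_triangle_ineq] simp: abs_mult)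
  also have "\<dots> = a * (\<Sum>i\<in>UNIV. \<bar>p $ i\<bar>) + b * (\<Sum>i\<in>UNIV. \<bar>q $ i\<bar>)"
    by (simp add: sum.distrib sum_distrib_left)
  also have "\<dots> \<le> a * 1 + b * 1"
    using pq ab by (intro add_mono mult_left_mono) (auto simp: l1_ball_def)
  finally show "a *\<^sub>R p + b *\<^sub>R q \<in> l1_ball" using ab by (simp add: l1_ball_def)
qed

text \<open>This lemma and the next one say that \<open>max_abs\<close> is the support function of \<open>l1_ball\<close>.\<close>

lemma inner_le_max_abs:
  assumes "q \<in> l1_ball"
  shows "p \<bullet> q \<le> max_abs p"
proof -
  have le: "\<bar>p $ i\<bar> \<le> max_abs p" for i unfolding max_abs_def by (rule Max_ge) auto
  have "p \<bullet> q \<le> (\<Sum>i\<in>UNIV. max_abs p * \<bar>q $ i\<bar>)"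
    unfolding inner_vec_def
  proof (rule sum_mono)
    fix i :: 'a
    have "p $ i \<bullet> q $ i \<le> \<bar>p $ i\<bar> * \<bar>q $ i\<bar>" by (simp add: abs_mult[symmetric])
    also have "\<dots> \<le> max_abs p * \<bar>q $ i\<bar>" by (rule mult_right_mono[OF le]) simp
    finally show "p $ i \<bullet> q $ i \<le> max_abs p * \<bar>q $ i\<bar>" .
  qed
  also have "\<dots> = max_abs p * (\<Sum>i\<in>UNIV. \<bar>q $ i\<bar>)" by (simp add: sum_distrib_left)
  also have "\<dots> \<le> max_abs p * 1"
    using assms le[of undefined] by (intro mult_left_mono) (auto simp: l1_ball_def)
  finally show ?thesis by simp
qed

lemma max_abs_attained: "\<exists>q\<in>l1_ball. max_abs p = p \<bullet> q"
proof -
  have "max_abs p \<in> range (\<lambda>i. \<bar>p $ i\<bar>)" unfolding max_abs_def by (rule Max_in) auto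
  then obtain i where i: "max_abs p = \<bar>p $ i\<bar>" by auto
  \<comment> \<open>a signed basis vector in a direction where \<open>\<bar>p\<^sub>i\<bar>\<close> is largest\<close>
  define q :: "real ^ 'a" where "q = axis i (sgn (p $ i))"
  have "(\<Sum>j\<in>UNIV. \<bar>q $ j\<bar>) = (\<Sum>j\<in>UNIV. if j = i then \<bar>sgn (p $ i)\<bar> else 0)"
    by (intro sum.cong) (auto simp: q_def axis_def)
  also have "\<dots> \<le> 1" by (simp add: abs_sgn_eq)
  finally have "q \<in> l1_ball" by (simp add: l1_ball_def)
  moreover have "p \<bullet> q = max_abs p" by (simp add: i q_def inner_axis abs_sgn)
  ultimately show ?thesis by force
qed

lemma max_abs_lipschitz: "max_abs p \<le> max_abs q + 1 * norm (p - q)"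
proof -
  obtain b where b: "b \<in> l1_ball" "max_abs p = p \<bullet> b" using max_abs_attained by blast
  have "norm b \<le> 1" using b(1) norm_le_l1_cart[of b] by (simp add: l1_ball_def)
  have "p \<bullet> b = q \<bullet> b + (p - q) \<bullet> b" by (simp add: inner_diff_left)
  also have "\<dots> \<le> max_abs q + norm (p - q) * norm b"
    by (intro add_mono inner_le_max_abs[OF b(1)] norm_cauchy_schwarz)
  also have "\<dots> \<le> max_abs q + norm (p - q) * 1"
    using \<open>norm b \<le> 1\<close> by (intro add_mono mult_left_mono) auto
  finally show ?thesis using b(2) by simp
qed

text \<open>For the \<open>\<ell>\<^sup>1\<close> ball the Hopf--Lax function is restated with displacements \<open>y\<close> in place of
  velocities, the form in which it is compared with the lattice model.\<close>

lemma hopf_lax_l1_ge: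
  assumes "bounded (range g)" "(\<Sum>i\<in>UNIV. \<bar>y $ i\<bar>) \<le> t"
  shows "g (x + y) \<le> hopf_lax l1_ball g (x, t)"
proof -
  have nn: "0 \<le> (\<Sum>i\<in>UNIV. \<bar>y $ i\<bar>)" by (simp add: sum_nonneg)
  \<comment> \<open>At \<open>t = 0\<close> the scaling degenerates, but then \<open>y = 0\<close>.\<close>
  have 1: "t *\<^sub>R ((1 / t) *\<^sub>R y) = y"
  proof (cases "t = 0")
    case True
    then have "(\<Sum>i\<in>UNIV. \<bar>y $ i\<bar>) = 0" using assms(2) nn by simp
    then have "y = 0" by (simp add: sum_nonneg_eq_0_iff vec_eq_iff)
    then show ?thesis by simp
  qed simp
  have "(\<Sum>i\<in>UNIV. \<bar>((1 / t) *\<^sub>R y) $ i\<bar>) = (\<Sum>i\<in>UNIV. \<bar>y $ i\<bar>) / \<bar>t\<bar>"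
    by (simp add: abs_mult sum_divide_distrib)
  also have "\<dots> \<le> 1" using assms(2) nn by (auto simp: divide_le_eq_1)
  finally have "(1 / t) *\<^sub>R y \<in> l1_ball" by (simp add: l1_ball_def)
  from hopf_lax_ge[OF assms(1) this, of x t] show ?thesis unfolding 1 .
qed

lemma hopf_lax_l1_attained:
  assumes "continuous_on UNIV g" "t \<ge> 0"
  obtains y where "(\<Sum>i\<in>UNIV. \<bar>y $ i\<bar>) \<le> t" "hopf_lax l1_ball g (x, t) = g (x + y)"
proof -
  have "l1_ball \<noteq> {}" using max_abs_attained by blast
  then obtain q where q: "q \<in> l1_ball" "hopf_lax l1_ball g (x, t) = g (x + t *\<^sub>R q)"
    using hopf_lax_attained[OF compact_l1_ball _ assms(1)] by blast
  have "(\<Sum>i\<in>UNIV. \<bar>(t *\<^sub>R q) $ i\<bar>) = t * (\<Sum>i\<in>UNIV. \<bar>q $ i\<bar>)"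
    using assms(2) by (simp add: abs_mult sum_distrib_left)
  also have "\<dots> \<le> t * 1" using q(1) assms(2) by (intro mult_left_mono) (auto simp: l1_ball_def)
  finally have "(\<Sum>i\<in>UNIV. \<bar>(t *\<^sub>R q) $ i\<bar>) \<le> t" by simp
  then show thesis using q(2) by (rule that)
qed

section \<open>The discrete height as a maximum over a lattice ball\<close>

lemma finite_neighbours: "finite neighbours" and zero_in_neighbours: "0 \<in> neighbours"
  by (auto simp: neighbours_def)

lemma neighbours_l1:
  assumes "a \<in> neighbours"
  shows "(\<Sum>i\<in>UNIV. \<bar>a $ i\<bar>) \<le> 1"
proof -
  consider "a = 0" | i where "a = axis i 1" | i where "a = - axis i 1"
    using assms by (auto simp: neighbours_def)
  then show ?thesis
  proof cases
    case (2 i)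
    have "(\<Sum>j\<in>UNIV. \<bar>a $ j\<bar>) = (\<Sum>j\<in>UNIV. if j = i then 1 else 0)"
      unfolding 2 by (intro sum.cong) (auto simp: axis_def)
    then show ?thesis by simp
  next
    case (3 i)
    have "(\<Sum>j\<in>UNIV. \<bar>a $ j\<bar>) = (\<Sum>j\<in>UNIV. if j = i then 1 else 0)"
      unfolding 3 by (intro sum.cong) (auto simp: axis_def)
    then show ?thesis by simp
  qed simp
qed

text \<open>A unit step along a nonzero coordinate lowers the \<open>\<ell>\<^sup>1\<close> norm by one. The zero step is needed
  at \<open>k = 0\<close>; because it is allowed, \<open>t\<close> steps reach the whole ball and not only the points whose
  norm has the parity of \<open>t\<close>.\<close>

lemma l1_step_towards_origin:
  fixes k :: "int ^ 'n"
  assumes "(\<Sum>i\<in>UNIV. \<bar>k $ i\<bar>) \<le> int (Suc t)"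
  obtains a where "a \<in> neighbours" "(\<Sum>i\<in>UNIV. \<bar>(k - a) $ i\<bar>) \<le> int t"
proof (cases "k = 0")
  case True
  then show thesis using that[OF zero_in_neighbours] by simp
next
  case False
  then obtain i where i: "k $ i \<noteq> 0" by (auto simp: vec_eq_iff)
  define a :: "int ^ 'n" where "a = (if k $ i > 0 then axis i 1 else - axis i 1)"
  have "a \<in> neighbours" by (auto simp: a_def neighbours_def)
  have "\<bar>(k - a) $ j\<bar> = \<bar>k $ j\<bar> - (if j = i then 1 else 0)" for j
    using i by (auto simp: a_def axis_def)
  then have "(\<Sum>j\<in>UNIV. \<bar>(k - a) $ j\<bar>) = (\<Sum>j\<in>UNIV. \<bar>k $ j\<bar>) - 1"
    by (simp add: sum_subtractf)
  then show thesis using that[OF \<open>a \<in> neighbours\<close>] assms by simp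
qed

lemma height_ge:
  assumes "(\<Sum>i\<in>UNIV. \<bar>k $ i\<bar>) \<le> int t"
  shows "u0 (\<epsilon> *\<^sub>R (\<chi> i. real_of_int ((x + k) $ i))) \<le> height u0 \<epsilon> x t"
  using assms
proof (induction t arbitrary: x k)
  case 0
  have "0 \<le> (\<Sum>i\<in>UNIV. \<bar>k $ i\<bar>)" by (simp add: sum_nonneg)
  with 0 have "(\<Sum>i\<in>UNIV. \<bar>k $ i\<bar>) = 0" by simp
  then have "k = 0" by (simp add: sum_nonneg_eq_0_iff vec_eq_iff)
  then show ?case by simp
next
  case (Suc t)
  obtain a where a: "a \<in> neighbours" "(\<Sum>i\<in>UNIV. \<bar>(k - a) $ i\<bar>) \<le> int t"
    using l1_step_towards_origin[OF Suc.prems] .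
  have "u0 (\<epsilon> *\<^sub>R (\<chi> i. real_of_int ((x + k) $ i))) \<le> height u0 \<epsilon> (x + a) t"
    using Suc.IH[OF a(2), of "x + a"] by (simp add: algebra_simps)
  also have "\<dots> \<le> height u0 \<epsilon> x (Suc t)"
    using a(1) finite_neighbours by (auto intro: Max_ge)
  finally show ?case .
qed

lemma height_attained:
  obtains k where "(\<Sum>i\<in>UNIV. \<bar>k $ i\<bar>) \<le> int t"
    "height u0 \<epsilon> x t = u0 (\<epsilon> *\<^sub>R (\<chi> i. real_of_int ((x + k) $ i)))"
proof -
  have "\<exists>k. (\<Sum>i\<in>UNIV. \<bar>k $ i\<bar>) \<le> int t \<and>
    height u0 \<epsilon> x t = u0 (\<epsilon> *\<^sub>R (\<chi> i. real_of_int ((x + k) $ i)))"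
  proof (induction t arbitrary: x)
    case 0
    show ?case by (intro exI[of _ 0]) simp
  next
    case (Suc t)
    have "height u0 \<epsilon> x (Suc t) \<in> (\<lambda>a. height u0 \<epsilon> (x + a) t) ` neighbours"
      using finite_neighbours zero_in_neighbours unfolding height.simps by (intro Max_in) auto
    then obtain a where a: "a \<in> neighbours" "height u0 \<epsilon> x (Suc t) = height u0 \<epsilon> (x + a) t"
      by blast
    obtain k where k: "(\<Sum>i\<in>UNIV. \<bar>k $ i\<bar>) \<le> int t"
      "height u0 \<epsilon> (x + a) t = u0 (\<epsilon> *\<^sub>R (\<chi> i. real_of_int ((x + a + k) $ i)))"
      using Suc.IH by blast
    have "(\<Sum>i\<in>UNIV. \<bar>(a + k) $ i\<bar>) \<le> (\<Sum>i\<in>UNIV. \<bar>a $ i\<bar> + \<bar>k $ i\<bar>)"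
      by (intro sum_mono) (simp add: abs_triangle_ineq)
    also have "\<dots> \<le> int (Suc t)" using neighbours_l1[OF a(1)] k(1) by (simp add: sum.distrib)
    finally show ?case using a(2) k(2) by (intro exI[of _ "a + k"]) (simp add: add.assoc)
  qed
  then show thesis using that by blast
qed

section \<open>Convergence of the rescaled heights\<close>

lemma norm_le_card:
  fixes x :: "real ^ 'n"
  assumes "\<And>i. \<bar>x $ i\<bar> \<le> c"
  shows "norm x \<le> real CARD('n) * c"
proof -
  have "norm x \<le> (\<Sum>i\<in>UNIV. \<bar>x $ i\<bar>)" by (rule norm_le_l1_cart)
  also have "\<dots> \<le> real CARD('n) * c" using assms by (intro sum_bounded_above) auto
  finally show ?thesis .
qed

lemma floor_rescaled:
  assumes "\<epsilon> > 0"
  shows "\<bar>\<epsilon> * real_of_int \<lfloor>r / \<epsilon>\<rfloor> - r\<bar> \<le> \<epsilon>"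
proof -
  have "\<epsilon> * real_of_int \<lfloor>r / \<epsilon>\<rfloor> \<le> \<epsilon> * (r / \<epsilon>)" "\<epsilon> * (r / \<epsilon>) \<le> \<epsilon> * (real_of_int \<lfloor>r / \<epsilon>\<rfloor> + 1)"
    using assms by (intro mult_left_mono; linarith)+
  then show ?thesis using assms by (simp add: algebra_simps abs_le_iff)
qed

text \<open>Rounding towards zero, and not down, keeps the rounded displacement inside the \<open>\<ell>\<^sup>1\<close> ball.\<close>

lemma truncation_exists:
  fixes r \<epsilon> :: real
  assumes "\<epsilon> > 0"
  shows "\<exists>k::int. \<bar>real_of_int k\<bar> \<le> \<bar>r\<bar> / \<epsilon> \<and> \<bar>\<epsilon> * real_of_int k - r\<bar> \<le> \<epsilon>"
proof -
  define n where "n = \<lfloor>\<bar>r\<bar> / \<epsilon>\<rfloor>"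
  have n: "\<bar>real_of_int n\<bar> \<le> \<bar>r\<bar> / \<epsilon>" "\<bar>\<epsilon> * real_of_int n - \<bar>r\<bar>\<bar> \<le> \<epsilon>"
    unfolding n_def using assms floor_rescaled[OF assms, of "\<bar>r\<bar>"] by simp_all
  show ?thesis
  proof (cases "r \<ge> 0")
    case True
    with n show ?thesis by (intro exI[of _ n]) simp
  next
    case False
    then have "\<bar>\<epsilon> * real_of_int (- n) - r\<bar> = \<bar>\<epsilon> * real_of_int n - \<bar>r\<bar>\<bar>" by simp
    with n show ?thesis by (intro exI[of _ "- n"]) simp
  qed
qed

text \<open>Upper bound: a lattice displacement \<open>k\<close> with \<open>\<bar>k\<bar>\<^sub>1 \<le> [t/\<epsilon>]\<close> gives the real displacement \<open>\<epsilon> k\<close>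
  of norm at most \<open>t\<close>, and only the rounding of \<open>x\<close> matters. Lower bound: an optimal real
  displacement \<open>y\<close> is rounded towards zero to a lattice displacement, whose norm is an integer at most
  \<open>t/\<epsilon>\<close> and hence at most \<open>[t/\<epsilon>]\<close>. Rounding \<open>x\<close> and \<open>y\<close> costs \<open>\<epsilon>\<close> each in every
  coordinate.\<close>

lemma rescaled_close_to_hopf_lax:
  fixes g :: "real ^ 'n \<Rightarrow> real"
  assumes g: "bounded (range g)" "continuous_on UNIV g"
    and mod: "\<And>x y. norm (x - y) \<le> real CARD('n) * (2 * \<epsilon>) \<Longrightarrow> \<bar>g x - g y\<bar> \<le> e"
    and \<epsilon>: "\<epsilon> > 0" and t: "t \<ge> 0"
  shows "\<bar>rescaled g \<epsilon> (x, t) - hopf_lax l1_ball g (x, t)\<bar> \<le> e"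
proof -
  define X :: "int ^ 'n" where "X = (\<chi> i. \<lfloor>x $ i / \<epsilon>\<rfloor>)"
  define N where "N = nat \<lfloor>t / \<epsilon>\<rfloor>"
  \<comment> \<open>the point of the lattice of spacing \<open>\<epsilon>\<close> with integer coordinates \<open>k\<close>\<close>
  define lat where "lat k = \<epsilon> *\<^sub>R (\<chi> i. real_of_int (k $ i))" for k :: "int ^ 'n"
  have N: "int N = \<lfloor>t / \<epsilon>\<rfloor>" using \<epsilon> t by (simp add: N_def)
  have res: "rescaled g \<epsilon> (x, t) = height g \<epsilon> X N" by (simp add: rescaled_def X_def N_def)
  have "height g \<epsilon> X N \<le> hopf_lax l1_ball g (x, t) + e"
  proof -
    obtain k where k: "(\<Sum>i\<in>UNIV. \<bar>k $ i\<bar>) \<le> int N" "height g \<epsilon> X N = g (lat (X + k))"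
      unfolding lat_def using height_attained by blast
    have "(\<Sum>i\<in>UNIV. \<bar>lat k $ i\<bar>) = \<epsilon> * real_of_int (\<Sum>i\<in>UNIV. \<bar>k $ i\<bar>)"
      using \<epsilon> by (simp add: lat_def abs_mult sum_distrib_left)
    also have "\<dots> \<le> \<epsilon> * (t / \<epsilon>)"
      using k(1) \<epsilon> unfolding N by (intro mult_left_mono) (auto simp: le_floor_iff)
    finally have "g (x + lat k) \<le> hopf_lax l1_ball g (x, t)"
      using \<epsilon> by (intro hopf_lax_l1_ge[OF g(1)]) simp
    moreover have "norm (lat (X + k) - (x + lat k)) \<le> real CARD('n) * (2 * \<epsilon>)"
    proof (rule norm_le_card)
      fix i
      have "(lat (X + k) - (x + lat k)) $ i = \<epsilon> * real_of_int \<lfloor>x $ i / \<epsilon>\<rfloor> - x $ i"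
        by (simp add: lat_def X_def algebra_simps)
      then show "\<bar>(lat (X + k) - (x + lat k)) $ i\<bar> \<le> 2 * \<epsilon>"
        using floor_rescaled[OF \<epsilon>, of "x $ i"] \<epsilon> by simp
    qed
    ultimately show ?thesis using mod k(2) by fastforce
  qed
  moreover have "hopf_lax l1_ball g (x, t) \<le> height g \<epsilon> X N + e"
  proof -
    obtain y where y: "(\<Sum>i\<in>UNIV. \<bar>y $ i\<bar>) \<le> t" "hopf_lax l1_ball g (x, t) = g (x + y)"
      using hopf_lax_l1_attained[OF g(2) t] by blast
    obtain f :: "'n \<Rightarrow> int" where
      f: "\<And>i. \<bar>real_of_int (f i)\<bar> \<le> \<bar>y $ i\<bar> / \<epsilon>" "\<And>i. \<bar>\<epsilon> * real_of_int (f i) - y $ i\<bar> \<le> \<epsilon>"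
      using choice[of "\<lambda>i k. \<bar>real_of_int k\<bar> \<le> \<bar>y $ i\<bar> / \<epsilon> \<and> \<bar>\<epsilon> * real_of_int k - y $ i\<bar> \<le> \<epsilon>"]
        truncation_exists[OF \<epsilon>] by blast
    define k :: "int ^ 'n" where "k = (\<chi> i. f i)"
    have "real_of_int (\<Sum>i\<in>UNIV. \<bar>k $ i\<bar>) \<le> (\<Sum>i\<in>UNIV. \<bar>y $ i\<bar> / \<epsilon>)"
      using f(1) by (auto simp: k_def intro!: sum_mono)
    also have "\<dots> \<le> t / \<epsilon>"
      using y(1) \<epsilon> by (simp add: sum_divide_distrib[symmetric] divide_right_mono)
    finally have "(\<Sum>i\<in>UNIV. \<bar>k $ i\<bar>) \<le> int N" unfolding N by (simp add: le_floor_iff)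
    then have "g (lat (X + k)) \<le> height g \<epsilon> X N" unfolding lat_def by (rule height_ge)
    moreover have "norm ((x + y) - lat (X + k)) \<le> real CARD('n) * (2 * \<epsilon>)"
    proof (rule norm_le_card)
      fix i
      have "((x + y) - lat (X + k)) $ i = 
        - (\<epsilon> * real_of_int \<lfloor>x $ i / \<epsilon>\<rfloor> - x $ i) - (\<epsilon> * real_of_int (f i) - y $ i)"
        by (simp add: lat_def X_def k_def algebra_simps)
      then show "\<bar>((x + y) - lat (X + k)) $ i\<bar> \<le> 2 * \<epsilon>"
        using floor_rescaled[OF \<epsilon>, of "x $ i"] f(2)[of i] by linarith
    qed
    ultimately show ?thesis using mod y(2) by fastforce
  qed
  ultimately show ?thesis unfolding res by linarith
qed

lemma rescaled_uniform_limit: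
  fixes g :: "real ^ 'n \<Rightarrow> real"
  assumes "BUC UNIV g" "K \<subseteq> UNIV \<times> {0..}"
  shows "uniform_limit K (\<lambda>\<epsilon>. rescaled g \<epsilon>) (hopf_lax l1_ball g) (at_right 0)"
proof (rule uniform_limitI)
  fix e :: real assume e: "e > 0"
  have bg: "bounded (range g)" and ug: "uniformly_continuous_on UNIV g"
    using assms(1) by (auto simp: BUC_def)
  have cg: "continuous_on UNIV g" by (rule uniformly_continuous_imp_continuous[OF ug])
  obtain d where d: "d > 0" "\<And>x y. dist x y < d \<Longrightarrow> dist (g x) (g y) < e / 2"
    using ug half_gt_zero[OF e] unfolding uniformly_continuous_on_def by (metis UNIV_I)
  let ?n = "real CARD('n)"
  show "\<forall>\<^sub>F \<epsilon> in at_right 0. \<forall>z\<in>K. dist (rescaled g \<epsilon> z) (hopf_lax l1_ball g z) < e"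
    unfolding eventually_at_right_field
  proof (intro exI[of _ "d / (2 * ?n)"] conjI allI impI ballI)
    show "0 < d / (2 * ?n)" using d(1) by simp
    fix \<epsilon> z assume \<epsilon>: "0 < \<epsilon>" "\<epsilon> < d / (2 * ?n)" and z: "z \<in> K"
    have small: "?n * (2 * \<epsilon>) < d" using \<epsilon>(2) by (simp add: field_simps)
    have mod: "\<bar>g x - g y\<bar> \<le> e / 2" if "norm (x - y) \<le> ?n * (2 * \<epsilon>)" for x y
      using d(2)[of x y] that small by (simp add: dist_norm)
    have "\<bar>rescaled g \<epsilon> (fst z, snd z) - hopf_lax l1_ball g (fst z, snd z)\<bar> \<le> e / 2"
      using z assms(2) by (intro rescaled_close_to_hopf_lax[OF bg cg mod \<epsilon>(1)]) auto
    then show "dist (rescaled g \<epsilon> z) (hopf_lax l1_ball g z) < e"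
      using e by (simp add: dist_real_def)
  qed
qed

theorem theorem4p1:
  fixes T :: real and u0 :: "real ^ 'n \<Rightarrow> real"
  assumes "T > 0" and "BUC UNIV u0"
  shows "\<exists>u. BUC (UNIV \<times> {0..T}) u \<and> viscosity_solution_IVP max_abs T u0 u \<and>
    (\<forall>v. BUC (UNIV \<times> {0..T}) v \<and> viscosity_solution_IVP max_abs T u0 v \<longrightarrow>
      (\<forall>z \<in> UNIV \<times> {0..T}. v z = u z)) \<and>
    (\<forall>K. compact K \<and> K \<subseteq> UNIV \<times> {0..T} \<longrightarrow>
      uniform_limit K (\<lambda>\<epsilon>. rescaled u0 \<epsilon>) u (at_right 0))"
proof (intro exI[of _ "hopf_lax l1_ball u0"] conjI allI impI)
  let ?u = "hopf_lax (l1_ball :: (real ^ 'n) set) u0"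
  have ne: "(l1_ball :: (real ^ 'n) set) \<noteq> {}" using max_abs_attained by blast
  have bu: "bounded (range u0)" and cu: "continuous_on UNIV u0"
    using assms(2) by (auto simp: BUC_def intro: uniformly_continuous_imp_continuous)
  have BUC_u: "BUC S ?u" for S by (rule hopf_lax_BUC[OF compact_l1_ball ne assms(2)])
  then show "BUC (UNIV \<times> {0..T}) ?u" .
  have sub: "viscosity_subsolution max_abs (UNIV \<times> {0<..T}) ?u"
    by (rule hopf_lax_subsolution[OF compact_l1_ball convex_l1_ball ne bu cu inner_le_max_abs])
  have super: "viscosity_supersolution max_abs (UNIV \<times> {0<..T}) ?u"
    by (rule hopf_lax_supersolution[OF compact_l1_ball convex_l1_ball bu cu])
      (metis max_abs_attained order_refl)
  show "viscosity_solution_IVP max_abs T u0 ?u"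
    unfolding viscosity_solution_IVP_def viscosity_solution_def
    using sub super hopf_lax_initial[OF ne] BUC_u
    by (auto simp: BUC_def intro: uniformly_continuous_imp_continuous)
  show "\<forall>z\<in>UNIV \<times> {0..T}. v z = ?u z"
    if v: "BUC (UNIV \<times> {0..T}) v \<and> viscosity_solution_IVP max_abs T u0 v" for v
  proof (intro ballI antisym)
    fix z :: "(real ^ 'n) \<times> real" assume z: "z \<in> UNIV \<times> {0..T}"
    have vs: "viscosity_subsolution max_abs (UNIV \<times> {0<..T}) v"
      "viscosity_supersolution max_abs (UNIV \<times> {0<..T}) v" "\<And>x. v (x, 0) = ?u (x, 0)"
      using v hopf_lax_initial[OF ne] by (auto simp: viscosity_solution_IVP_def viscosity_solution_def)
    show "v z \<le> ?u z"
      by (rule comparison_principle[OF _ vs(1) BUC_u super max_abs_lipschitz _ z]) (use v vs(3) in auto)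
    show "?u z \<le> v z"
      by (rule comparison_principle[OF BUC_u sub _ vs(2) max_abs_lipschitz _ z]) (use v vs(3) in auto)
  qed
  show "uniform_limit K (\<lambda>\<epsilon>. rescaled u0 \<epsilon>) ?u (at_right 0)"
    if "compact K \<and> K \<subseteq> UNIV \<times> {0..T}" for K
    using that by (intro rescaled_uniform_limit[OF assms(2)]) auto
qed

end
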